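(* Let $\mathcal{G}=\{G_1,\dots,G_s\}$ be a set of real $n\times n$ matrices, let $A\in\mathbb{R}^{m\times n}$, $b\in\mathbb{R}^m$, and $P=\{x\in\mathbb{R}^n\mid Ax\le b\}$. If $\rho(\mathcal{G})<1$, $P$ is bounded, and the origin is in the interior of $P$, then $\mathcal{S}=S_r$ for some integer $r\ge 0$.
   Context: Inequalities between vectors are entrywise. $\mathcal{G}^k$ denotes the set of all products of length $k$ of matrices from $\mathcal{G}$ ($\mathcal{G}^0=\{I\}$). Define $\mathcal{S}:=\bigcap_{k=0}^{\infty}\{x\in\mathbb{R}^n\mid AGx\le b\ \ \forall G\in\mathcal{G}^k\}$ and $S_r:=\bigcap_{k=0}^{r}\{x\in\mathbb{R}^n\mid AGx\le b\ \ \forall G\in\mathcal{G}^k\}$. The joint spectral radius of $\mathcal{G}$ is $\rho(\mathcal{G}):=\lim_{k\to\infty}\max_{\sigma\in\{1,\dots,s\}^k}\|G_{\sigma_1}\cdots G_{\sigma_k}\|^{1/k}$ (independent of the matrix norm used). *)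

theory Defs
  imports "HOL-Analysis.Analysis"
begin

text \<open>Matrices with $m$ rows and $n$ columns are of type \<^typ>\<open>real^'n^'m\<close>, and the library
  order on \<^typ>\<open>real^'m\<close> is the entrywise one.\<close>

definition polyhedron_of :: "real^'n^'m \<Rightarrow> real^'m \<Rightarrow> (real^'n) set" where
  "polyhedron_of A b = {x. A *v x \<le> b}"

definition matrix_prod :: "(real^'n^'n) list \<Rightarrow> real^'n^'n" where
  "matrix_prod Ms = foldr (**) Ms (mat 1)"

definition products :: "(real^'n^'n) set \<Rightarrow> nat \<Rightarrow> (real^'n^'n) set" where
  "products \<G> k = {matrix_prod Ms | Ms. length Ms = k \<and> set Ms \<subseteq> \<G>}"

definition invariant_set ::
    "(real^'n^'n) set \<Rightarrow> real^'n^'m \<Rightarrow> real^'m \<Rightarrow> (real^'n) set" where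
  "invariant_set \<G> A b = (\<Inter>k. {x. \<forall>M\<in>products \<G> k. A *v (M *v x) \<le> b})"

definition invariant_set_upto ::
    "(real^'n^'n) set \<Rightarrow> real^'n^'m \<Rightarrow> real^'m \<Rightarrow> nat \<Rightarrow> (real^'n) set" where
  "invariant_set_upto \<G> A b r = (\<Inter>k\<in>{0..r}. {x. \<forall>M\<in>products \<G> k. A *v (M *v x) \<le> b})"

text \<open>The joint spectral radius of $G_1,\dots,G_s$. The limit does not depend on the matrix norm;
  the norm taken here is the operator norm induced by the Euclidean norm. A word $\sigma$ in
  $\{1,\dots,s\}^k$ is a list of indices. The maximum is over a finite nonempty set
  only for $s \ge 1$, and the term at $k = 0$ is irrelevant to the limit.\<close>

definition joint_spectral_radius :: "(nat \<Rightarrow> real^'n^'n) \<Rightarrow> nat \<Rightarrow> real" where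
  "joint_spectral_radius G s =
     lim (\<lambda>k. Max ((\<lambda>\<sigma>. root k (onorm ((*v) (matrix_prod (map G \<sigma>)))))
                    ` {\<sigma>. length \<sigma> = k \<and> set \<sigma> \<subseteq> {1..s}}))"

end

theory Submission
  imports Defs
begin

text \<open>The polytope $P$ is squeezed between two balls: a ball of some radius $e > 0$ about the origin
  is contained in it, and it is contained in a ball of some radius $R$.  When the joint spectral
  radius is below $1$, all products of $k$ matrices have operator norm tending uniformly to $0$.
  Hence for all large $k$ every such product maps the ball of radius $R$, and in particular
  every point of $P$, into the ball of radius $e$ and so into $P$.  Any point that satisfies the
  constraint for $k = 0$ therefore satisfies the constraints of all large $k$ automatically, and
  only finitely many constraints matter.

  The decay of the products is read off from the limit that defines the joint spectral radius.
  This needs that limit to exist: the term \<^const>\<open>lim\<close> of a divergent sequence carries no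
  information.  Existence is Fekete's lemma in multiplicative form
  (\<open>submultiplicative_root_convergent\<close>), applied to the largest norm of a product of length $k$,
  which is submultiplicative because a word of length $m + n$ splits into one of length $m$ and
  one of length $n$.\<close>

section \<open>Fekete's lemma for submultiplicative sequences\<close>

text \<open>One value below $c^m$ controls the whole sequence: splitting off blocks of length $m$
  reduces any index to a remainder below $m$, and the finitely many remainders are absorbed
  into the constant.\<close>

lemma submultiplicative_geometric_bound:
  fixes a :: "nat \<Rightarrow> real"
  assumes nonneg: "\<And>n. 0 \<le> a n"
    and submult: "\<And>m n. a (m + n) \<le> a m * a n"
    and "0 < c" "0 < m" "a m \<le> c ^ m"
  obtains K where "0 < K" "\<And>n. a n \<le> K * c ^ n"
proof
  define K where "K = 1 + (\<Sum>r<m. a r / c ^ r)"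
  have terms_nonneg: "0 \<le> a r / c ^ r" for r
    using nonneg \<open>0 < c\<close> by simp
  then show "0 < K"
    unfolding K_def by (simp add: sum_nonneg add_pos_nonneg)
  show "a n \<le> K * c ^ n" for n
  proof (induction n rule: less_induct)
    case (less n)
    show ?case
    proof (cases "n < m")
      case True
      then have "a n / c ^ n \<le> (\<Sum>r<m. a r / c ^ r)"
        using terms_nonneg by (intro member_le_sum) auto
      then have "a n / c ^ n \<le> K"
        by (simp add: K_def)
      then show ?thesis
        using \<open>0 < c\<close> by (simp add: divide_le_eq)
    next
      case False
      have "a n \<le> a m * a (n - m)"
        using submult[of m "n - m"] False by simp
      also have "\<dots> \<le> c ^ m * (K * c ^ (n - m))"
        using less.IH[of "n - m"] False assms by (intro mult_mono) auto
      also have "\<dots> = K * c ^ n"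
        using False by (simp flip: power_add)
      finally show ?thesis .
    qed
  qed
qed

text \<open>The limit is the infimum of the roots: the previous bound, for $c$ just above that infimum,
  gives an upper estimate $K^{1/n} c$ of the $n$-th root, and $K^{1/n} \to 1$.\<close>

lemma submultiplicative_root_convergent:
  fixes a :: "nat \<Rightarrow> real"
  assumes nonneg: "\<And>n. 0 \<le> a n"
    and submult: "\<And>m n. a (m + n) \<le> a m * a n"
  shows "convergent (\<lambda>n. root n (a n))"
proof -
  define L where "L = (INF n\<in>{0<..}. root n (a n))"
  have bdd: "bdd_below ((\<lambda>n. root n (a n)) ` {0<..})"
    using nonneg by (intro bdd_belowI2[where m = 0]) simp
  have "0 \<le> L"
    unfolding L_def using nonneg by (intro cINF_greatest) auto
  have "(\<lambda>n. root n (a n)) \<longlonglongrightarrow> L"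
  proof (rule order_tendstoI)
    fix y assume "y < L"
    show "\<forall>\<^sub>F n in sequentially. y < root n (a n)"
      using eventually_gt_at_top[of 0]
    proof eventually_elim
      case (elim n)
      then have "L \<le> root n (a n)"
        unfolding L_def using bdd by (intro cINF_lower) auto
      with \<open>y < L\<close> show ?case by simp
    qed
  next
    fix y assume "L < y"
    then obtain c where c: "L < c" "c < y"
      using dense by blast
    then have "0 < c"
      using \<open>0 \<le> L\<close> by simp
    have "\<exists>m\<in>{0<..}. root m (a m) < c"
      using c(1) bdd by (subst (asm) L_def, subst (asm) cINF_less_iff) auto
    then obtain m where m: "0 < m" "root m (a m) < c"
      by auto
    have "a m = root m (a m) ^ m"
      using m(1) nonneg by simp
    also have "\<dots> \<le> c ^ m"
      using m nonneg by (intro power_mono) auto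
    finally have "a m \<le> c ^ m" .
    with nonneg submult \<open>0 < c\<close> m(1) obtain K where K: "0 < K" "\<And>n. a n \<le> K * c ^ n"
      by (rule submultiplicative_geometric_bound) auto
    have "(\<lambda>n. root n K * c) \<longlonglongrightarrow> 1 * c"
      using LIMSEQ_root_const[OF K(1)] by (intro tendsto_intros)
    then have "\<forall>\<^sub>F n in sequentially. root n K * c < y"
      using c(2) by (intro order_tendstoD) auto
    then show "\<forall>\<^sub>F n in sequentially. root n (a n) < y"
      using eventually_gt_at_top[of 0]
    proof eventually_elim
      case (elim n)
      have "root n (a n) \<le> root n (K * c ^ n)"
        using elim(2) K(2) by simp
      also have "\<dots> = root n K * c"
        using elim(2) \<open>0 < c\<close> by (simp add: real_root_mult real_root_power_cancel)
      finally show ?case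
        using elim(1) by simp
    qed
  qed
  then show ?thesis
    by (rule convergentI)
qed

lemma tendsto_zero_if_root_limit_less_1:
  fixes a :: "nat \<Rightarrow> real"
  assumes nonneg: "\<And>n. 0 \<le> a n"
    and lim: "(\<lambda>n. root n (a n)) \<longlonglongrightarrow> L" and "L < 1"
  shows "a \<longlonglongrightarrow> 0"
proof -
  obtain c where c: "max 0 L < c" "c < 1"
    using dense[of "max 0 L" 1] \<open>L < 1\<close> by auto
  have "\<forall>\<^sub>F n in sequentially. root n (a n) < c"
    using lim c by (intro order_tendstoD) auto
  then have bound: "\<forall>\<^sub>F n in sequentially. a n \<le> c ^ n"
    using eventually_gt_at_top[of 0]
  proof eventually_elim
    case (elim n)
    have "a n = root n (a n) ^ n"
      using elim(2) nonneg by simp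
    also have "\<dots> \<le> c ^ n"
      using elim nonneg by (intro power_mono) auto
    finally show ?case .
  qed
  have "(\<lambda>n. c ^ n) \<longlonglongrightarrow> 0"
    using c by (intro LIMSEQ_realpow_zero) auto
  then show ?thesis
    by (rule tendsto_sandwich[OF always_eventually bound tendsto_const, rotated])
      (use nonneg in auto)
qed

section \<open>Norms of products of matrices\<close>

lemma matrix_prod_append: "matrix_prod (xs @ ys) = matrix_prod xs ** matrix_prod ys"
  by (induction xs) (simp_all add: matrix_prod_def matrix_mul_assoc)

lemma onorm_matrix_mul_le:
  fixes M :: "real^'n^'m" and N :: "real^'k^'n"
  shows "onorm ((*v) (M ** N)) \<le> onorm ((*v) M) * onorm ((*v) N)"
proof -
  have "(*v) (M ** N) = (*v) M \<circ> (*v) N"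
    by (auto simp: matrix_vector_mul_assoc)
  then show ?thesis
    using onorm_compose[OF matrix_vector_mul_bounded_linear matrix_vector_mul_bounded_linear]
    by metis
qed

definition words :: "nat \<Rightarrow> nat \<Rightarrow> nat list set" where
  "words s k = {\<sigma>. length \<sigma> = k \<and> set \<sigma> \<subseteq> {1..s}}"

definition max_product_norm :: "(nat \<Rightarrow> real^'n^'n) \<Rightarrow> nat \<Rightarrow> nat \<Rightarrow> real" where
  "max_product_norm G s k = Max ((\<lambda>\<sigma>. onorm ((*v) (matrix_prod (map G \<sigma>)))) ` words s k)"

lemma finite_words: "finite (words s k)"
  using finite_lists_length_eq[of "{1..s}" k] by (simp add: words_def conj_commute)

lemma words_nonempty: "1 \<le> s \<Longrightarrow> words s k \<noteq> {}"
  by (auto simp: words_def intro!: exI[of _ "replicate k 1"])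

lemma onorm_le_max_product_norm:
  "\<sigma> \<in> words s k \<Longrightarrow> onorm ((*v) (matrix_prod (map G \<sigma>))) \<le> max_product_norm G s k"
  unfolding max_product_norm_def by (intro Max_ge) (auto simp: finite_words)

lemma max_product_norm_nonneg:
  assumes "1 \<le> s"
  shows "0 \<le> max_product_norm G s k"
proof -
  obtain \<sigma> where "\<sigma> \<in> words s k"
    using words_nonempty[OF assms] by auto
  then have "onorm ((*v) (matrix_prod (map G \<sigma>))) \<le> max_product_norm G s k"
    by (rule onorm_le_max_product_norm)
  then show ?thesis
    using onorm_pos_le[OF matrix_vector_mul_bounded_linear] order_trans by blast
qed

lemma max_product_norm_submultiplicative:
  assumes "1 \<le> s"
  shows "max_product_norm G s (k + l) \<le> max_product_norm G s k * max_product_norm G s l"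
proof -
  have "onorm ((*v) (matrix_prod (map G \<sigma>))) \<le> max_product_norm G s k * max_product_norm G s l"
    if \<sigma>: "\<sigma> \<in> words s (k + l)" for \<sigma>
  proof -
    have parts: "take k \<sigma> \<in> words s k" "drop k \<sigma> \<in> words s l"
      using \<sigma> by (auto simp: words_def dest: in_set_takeD in_set_dropD)
    have "matrix_prod (map G \<sigma>) = matrix_prod (map G (take k \<sigma>)) ** matrix_prod (map G (drop k \<sigma>))"
      by (simp flip: matrix_prod_append map_append)
    then have "onorm ((*v) (matrix_prod (map G \<sigma>)))
        \<le> onorm ((*v) (matrix_prod (map G (take k \<sigma>)))) * onorm ((*v) (matrix_prod (map G (drop k \<sigma>))))"
      by (simp add: onorm_matrix_mul_le)
    also have "\<dots> \<le> max_product_norm G s k * max_product_norm G s l"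
      using parts assms
      by (intro mult_mono onorm_le_max_product_norm max_product_norm_nonneg
          onorm_pos_le matrix_vector_mul_bounded_linear)
    finally show ?thesis .
  qed
  then show ?thesis
    using words_nonempty[OF assms] unfolding max_product_norm_def[of G s "k + l"]
    by (subst Max_le_iff) (auto simp: finite_words)
qed

text \<open>The index $0$ is excluded because \<^term>\<open>root 0\<close> is constantly $0$ by convention.\<close>

lemma Max_root_eq_root_max_product_norm:
  assumes "1 \<le> s" "0 < k"
  shows "Max ((\<lambda>\<sigma>. root k (onorm ((*v) (matrix_prod (map G \<sigma>))))) ` words s k)
    = root k (max_product_norm G s k)"
proof -
  have "mono (root k)"
    using assms by (intro monoI) simp
  from mono_Max_commute[OF this, of "(\<lambda>\<sigma>. onorm ((*v) (matrix_prod (map G \<sigma>)))) ` words s k"]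
  show ?thesis
    using assms by (simp add: max_product_norm_def finite_words words_nonempty image_image)
qed

lemma max_product_norm_root_tendsto:
  assumes "1 \<le> s"
  shows "(\<lambda>k. root k (max_product_norm G s k)) \<longlonglongrightarrow> joint_spectral_radius G s"
proof -
  let ?X = "\<lambda>k. Max ((\<lambda>\<sigma>. root k (onorm ((*v) (matrix_prod (map G \<sigma>))))) ` words s k)"
  have conv: "convergent (\<lambda>k. root k (max_product_norm G s k))"
    using assms by (intro submultiplicative_root_convergent max_product_norm_nonneg
        max_product_norm_submultiplicative)
  have eq: "\<forall>\<^sub>F k in sequentially. ?X k = root k (max_product_norm G s k)"
    using eventually_gt_at_top[of 0]
    by eventually_elim (rule Max_root_eq_root_max_product_norm[OF assms])
  have "convergent ?X"
    using conv convergent_cong[OF eq] by simp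
  then have "?X \<longlonglongrightarrow> joint_spectral_radius G s"
    unfolding joint_spectral_radius_def words_def by (simp add: convergent_LIMSEQ_iff)
  then show ?thesis
    using tendsto_cong[OF eq] by simp
qed

lemma max_product_norm_tendsto_0:
  assumes "1 \<le> s" "joint_spectral_radius G s < 1"
  shows "max_product_norm G s \<longlonglongrightarrow> 0"
  using assms by (intro tendsto_zero_if_root_limit_less_1[OF _ max_product_norm_root_tendsto]
      max_product_norm_nonneg)

lemma norm_products_mult_le:
  assumes "M \<in> products (G ` {1..s}) k"
  shows "norm (M *v x) \<le> max_product_norm G s k * norm x"
proof -
  obtain Ms where Ms: "M = matrix_prod Ms" "length Ms = k" "set Ms \<subseteq> G ` {1..s}"
    using assms by (auto simp: products_def)
  then have "Ms \<in> lists (G ` {1..s})"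
    by (simp add: in_lists_conv_set subset_iff)
  then obtain \<sigma> where \<sigma>: "Ms = map G \<sigma>" "set \<sigma> \<subseteq> {1..s}"
    by (auto simp: lists_image)
  then have "\<sigma> \<in> words s k"
    using Ms by (simp add: words_def)
  then have "onorm ((*v) M) \<le> max_product_norm G s k"
    using Ms(1) \<sigma>(1) onorm_le_max_product_norm by blast
  moreover have "norm (M *v x) \<le> onorm ((*v) M) * norm x"
    by (intro onorm matrix_vector_mul_bounded_linear)
  ultimately show ?thesis
    using mult_right_mono[OF _ norm_ge_zero] order_trans by blast
qed

section \<open>Finite determination of the invariant set\<close>

lemma products_0: "products \<G> 0 = {mat 1}"
  by (auto simp: products_def matrix_prod_def)

lemma invariant_set_upto_subset_polyhedron: "invariant_set_upto \<G> A b r \<subseteq> polyhedron_of A b"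
  by (force simp: invariant_set_upto_def polyhedron_of_def products_0)

theorem theorem3p2:
  fixes G :: "nat \<Rightarrow> real^'n^'n" and s :: nat
    and A :: "real^'n^'m" and b :: "real^'m"
  assumes "s \<ge> 1"
    and "joint_spectral_radius G s < 1"
    and "bounded (polyhedron_of A b)"
    and "0 \<in> interior (polyhedron_of A b)"
  shows "\<exists>r::nat. invariant_set (G ` {1..s}) A b = invariant_set_upto (G ` {1..s}) A b r"
proof -
  obtain e where e: "0 < e" "ball 0 e \<subseteq> polyhedron_of A b"
    using assms(4) by (auto simp: mem_interior)
  obtain R where R: "0 < R" "\<And>x. x \<in> polyhedron_of A b \<Longrightarrow> norm x \<le> R"
    using assms(3) by (auto simp: bounded_pos)
  have "\<forall>\<^sub>F k in sequentially. max_product_norm G s k < e / R"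
    using max_product_norm_tendsto_0[OF assms(1,2)] e(1) R(1) by (intro order_tendstoD) auto
  then obtain r where r: "\<And>k. r \<le> k \<Longrightarrow> max_product_norm G s k < e / R"
    by (auto simp: eventually_sequentially)
  have late: "A *v (M *v x) \<le> b"
    if "x \<in> polyhedron_of A b" "r \<le> k" "M \<in> products (G ` {1..s}) k" for x k M
  proof -
    have "norm (M *v x) \<le> max_product_norm G s k * norm x"
      using that(3) by (rule norm_products_mult_le)
    also have "\<dots> \<le> max_product_norm G s k * R"
      using R(2)[OF that(1)] max_product_norm_nonneg[OF assms(1)] by (rule mult_left_mono)
    also have "\<dots> < e"
      using r[OF that(2)] R(1) by (simp add: less_divide_eq)
    finally have "M *v x \<in> polyhedron_of A b"
      using e(2) by auto
    then show ?thesis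
      by (simp add: polyhedron_of_def)
  qed
  have "invariant_set_upto (G ` {1..s}) A b r \<subseteq> invariant_set (G ` {1..s}) A b"
  proof
    fix x assume x: "x \<in> invariant_set_upto (G ` {1..s}) A b r"
    then have "x \<in> polyhedron_of A b"
      using invariant_set_upto_subset_polyhedron by blast
    then have "A *v (M *v x) \<le> b" if "M \<in> products (G ` {1..s}) k" for k M
      using that x late by (cases "r \<le> k") (auto simp: invariant_set_upto_def)
    then show "x \<in> invariant_set (G ` {1..s}) A b"
      by (auto simp: invariant_set_def)
  qed
  moreover have "invariant_set (G ` {1..s}) A b \<subseteq> invariant_set_upto (G ` {1..s}) A b r"
    by (auto simp: invariant_set_def invariant_set_upto_def)
  ultimately show ?thesis
    by blast
qed

end
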